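(* Let $1 \leq p, q < \infty$, let $m$ be a non-negative integer ($m<\infty$), let $\tilde\nu_0, \ldots, \tilde\nu_m$ be positive regular Borel measures on $[0,\infty)$, each satisfying the $\Delta_2$-condition, let $\nu_n := \tilde\nu_n \otimes \lambda$ for $0\le n\le m$, and let $\mu$ be a positive Borel measure on $\mathbb{C}_+$. If the embedding $$A^p(\mathbb{C}_+, (\nu_n)_{n=0}^m) \hookrightarrow L^q(\mathbb{C}_+, \mu)$$ is bounded, then there exists a constant $C(\mu) > 0$ such that $$\mu(Q(a)) \leq C(\mu) \left[\sum_{n=0}^m \frac{\nu_n\left(\overline{Q(a)}\right)}{(\operatorname{Re}(a))^{np}}\right]^{\frac{q}{p}}$$ for each Carleson square $Q(a)$, $a \in \mathbb{C}_+$.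
   Context: $\mathbb{C}_+ := \{z : \operatorname{Re}(z) > 0\}$ and $\overline{\mathbb{C}_+} = [0,\infty)\times i\mathbb{R}$. A positive regular Borel measure $\tilde\nu$ on $[0,\infty)$ satisfies the $\Delta_2$-condition if $\sup_{r>0} \tilde\nu[0,2r)/\tilde\nu[0,r) < \infty$ (in particular $0<\tilde\nu[0,r)<\infty$ for all $r>0$). $\lambda$ is Lebesgue measure on $i\mathbb{R}$, and $\nu = \tilde\nu\otimes\lambda$ is a measure on $\overline{\mathbb{C}_+}$. For an analytic function $F$ on $\mathbb{C}_+$, $$\|F\|^p_{A^p_\nu} := \sup_{\varepsilon > 0} \int_{\overline{\mathbb{C}_+}} |F(z+\varepsilon)|^p\,d\nu(z),$$ and $A^p(\mathbb{C}_+, (\nu_n)_{n=0}^m)$ is the space of analytic $F : \mathbb{C}_+\to\mathbb{C}$ with $$\|F\|^p_{A^p(\mathbb{C}_+,(\nu_n)_{n=0}^m)} := \sum_{n=0}^m \|F^{(n)}\|^p_{A^p_{\nu_n}} < \infty.$$ The embedding into $L^q(\mathbb{C}_+,\mu)$ is bounded if there is $C>0$ with $\left(\int_{\mathbb{C}_+}|F|^q\,d\mu\right)^{1/q} \leq C\|F\|_{A^p(\mathbb{C}_+,(\nu_n)_{n=0}^m)}$ for all $F$ in the space. For $a \in \mathbb{C}_+$ the Carleson square centred at $a$ is $Q(a) := \{z = x+iy : 0 \leq x < 2\operatorname{Re}(a),\ |y - \operatorname{Im}(a)| \leq \operatorname{Re}(a)\}$, and $\overline{Q(a)}$ is its closure;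 $\mu(Q(a))$ means $\mu(Q(a)\cap\mathbb{C}_+)$. *)

theory Defs
  imports "HOL-Complex_Analysis.Complex_Analysis"
begin

definition right_half_plane :: "complex set" where
  "right_half_plane = {z. Re z > 0}"

definition closed_right_half_plane :: "complex set" where
  "closed_right_half_plane = {z. Re z \<ge> 0}"

(* Real powers of extended nonnegative reals; only used with exponent r > 0. *)
definition ennpowr :: "ennreal \<Rightarrow> real \<Rightarrow> ennreal" where
  "ennpowr x r = (if x = top then top else ennreal (enn2real x powr r))"

definition borel_measure_on :: "'a::topological_space set \<Rightarrow> 'a measure \<Rightarrow> bool" where
  "borel_measure_on S M \<longleftrightarrow> sets M = sets (restrict_space borel S)"

(* Outer regularity by relatively open subsets of S, inner regularity by compact sets. *)
definition regular_borel_measure_on :: "'a::topological_space set \<Rightarrow> 'a measure \<Rightarrow> bool" where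
  "regular_borel_measure_on S M \<longleftrightarrow>
     borel_measure_on S M \<and>
     (\<forall>A\<in>sets M. emeasure M A =
        (INF U\<in>{U. openin (top_of_set S) U \<and> A \<subseteq> U}. emeasure M U)) \<and>
     (\<forall>A\<in>sets M. emeasure M A =
        (SUP K\<in>{K. compact K \<and> K \<subseteq> A}. emeasure M K))"

(* The first conjunct is needed because quotients such as 0 / 0 and top / top are 0 in ennreal. *)
definition Delta2 :: "real measure \<Rightarrow> bool" where
  "Delta2 M \<longleftrightarrow>
     (\<forall>r>0. 0 < emeasure M {0..<r} \<and> emeasure M {0..<r} < top) \<and>
     (SUP r\<in>{0<..}. emeasure M {0..<2 * r} / emeasure M {0..<r}) < top"

(* The product of M with Lebesgue measure on the imaginary axis, transported to the complex plane. *)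
definition half_plane_measure :: "real measure \<Rightarrow> complex measure" where
  "half_plane_measure M =
     distr (M \<Otimes>\<^sub>M lborel) (restrict_space borel closed_right_half_plane) (\<lambda>(x, y). Complex x y)"

(* The p-th power of the norm. *)
definition Ap_norm_pow :: "real \<Rightarrow> complex measure \<Rightarrow> (complex \<Rightarrow> complex) \<Rightarrow> ennreal" where
  "Ap_norm_pow p N F =
     (SUP \<epsilon>\<in>{0<..}. \<integral>\<^sup>+ z. ennreal (norm (F (z + of_real \<epsilon>)) powr p) \<partial>N)"

definition Ap_sum_norm_pow ::
    "real \<Rightarrow> nat \<Rightarrow> (nat \<Rightarrow> complex measure) \<Rightarrow> (complex \<Rightarrow> complex) \<Rightarrow> ennreal" where
  "Ap_sum_norm_pow p m N F = (\<Sum>n\<le>m. Ap_norm_pow p (N n) ((deriv ^^ n) F))"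

definition Ap_space ::
    "real \<Rightarrow> nat \<Rightarrow> (nat \<Rightarrow> complex measure) \<Rightarrow> (complex \<Rightarrow> complex) set" where
  "Ap_space p m N =
     {F. F holomorphic_on right_half_plane \<and> Ap_sum_norm_pow p m N F < top}"

definition Ap_norm ::
    "real \<Rightarrow> nat \<Rightarrow> (nat \<Rightarrow> complex measure) \<Rightarrow> (complex \<Rightarrow> complex) \<Rightarrow> ennreal" where
  "Ap_norm p m N F = ennpowr (Ap_sum_norm_pow p m N F) (1 / p)"

definition Lq_norm :: "real \<Rightarrow> complex measure \<Rightarrow> (complex \<Rightarrow> complex) \<Rightarrow> ennreal" where
  "Lq_norm q \<mu> F = ennpowr (\<integral>\<^sup>+ z. ennreal (norm (F z) powr q) \<partial>\<mu>) (1 / q)"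

definition bounded_embedding ::
    "real \<Rightarrow> nat \<Rightarrow> (nat \<Rightarrow> complex measure) \<Rightarrow> real \<Rightarrow> complex measure \<Rightarrow> bool" where
  "bounded_embedding p m N q \<mu> \<longleftrightarrow>
     (\<exists>C::real. C > 0 \<and> (\<forall>F\<in>Ap_space p m N. Lq_norm q \<mu> F \<le> ennreal C * Ap_norm p m N F))"

definition carleson_square :: "complex \<Rightarrow> complex set" where
  "carleson_square a =
     {z. 0 \<le> Re z \<and> Re z < 2 * Re a \<and> \<bar>Im z - Im a\<bar> \<le> Re a}"

(* distr is degenerate for maps that are not measurable, so this is what makes half_plane_measure
   the intended measure. *)
lemma measurable_half_plane_map:
  assumes "borel_measure_on {0..} M"
  shows "(\<lambda>(x, y). Complex x y) \<in> M \<Otimes>\<^sub>M lborel \<rightarrow>\<^sub>M restrict_space borel closed_right_half_plane"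
proof (rule measurable_restrict_space2)
  have sM: "sets M = sets (restrict_space borel {0::real..})"
    using assms by (simp add: borel_measure_on_def)
  hence sp: "space M = {0..}"
    by (metis Int_UNIV_right sets_eq_imp_space_eq space_borel space_restrict_space)
  show "(\<lambda>(x, y). Complex x y) \<in> space (M \<Otimes>\<^sub>M lborel) \<rightarrow> closed_right_half_plane"
    by (auto simp: space_pair_measure sp closed_right_half_plane_def)
  have "(\<lambda>x. x) \<in> restrict_space borel {0::real..} \<rightarrow>\<^sub>M borel"
    by (intro measurable_restrict_space1) simp
  hence "(\<lambda>x. x) \<in> M \<rightarrow>\<^sub>M borel"
    using measurable_cong_sets[OF sM refl] by blast
  hence [measurable]: "fst \<in> M \<Otimes>\<^sub>M lborel \<rightarrow>\<^sub>M (borel :: real measure)"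
    using measurable_compose[OF measurable_fst] by fastforce
  have [measurable]: "snd \<in> M \<Otimes>\<^sub>M lborel \<rightarrow>\<^sub>M (borel :: real measure)"
    using measurable_snd[of M "lborel :: real measure"] by simp
  have "(\<lambda>w. complex_of_real (fst w) + \<i> * complex_of_real (snd w)) \<in> M \<Otimes>\<^sub>M lborel \<rightarrow>\<^sub>M borel"
    by measurable
  thus "(\<lambda>(x, y). Complex x y) \<in> M \<Otimes>\<^sub>M lborel \<rightarrow>\<^sub>M borel"
    by (simp add: Complex_eq case_prod_unfold)
qed

end

theory Submission
  imports Defs
begin

text \<open>The embedding is tested on \<open>F(z) = (Re a / (z + cnj a)) ^ N\<close>. On \<open>Q(a)\<close> one has \<open>norm (F z) \<ge> 4 ^ -N\<close>,
  so \<open>\<mu>(Q(a))\<close> is at most a constant times the \<open>q\<close>-th power of the \<open>L\<^sup>q\<close>-norm of \<open>F\<close>. Conversely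
  the squares \<open>Q_k\<close> with the same imaginary centre and side \<open>2 ^ k\<close> times as long exhaust the closed
  half plane, and \<open>norm (F z) \<le> (2 / 2 ^ k) ^ N\<close> off \<open>Q_(k - 1)\<close>, while the doubling condition gives
  \<open>\<nu>\<^sub>n(Q_k) \<le> (2 * D) ^ k * \<nu>\<^sub>n(Q(a))\<close>. For \<open>2 ^ N \<ge> 4 * D\<close> the resulting series is dominated by a geometric
  one. Each derivative of \<open>F\<close> gains a factor \<open>1 / Re a\<close>.\<close>

section \<open>Real powers of extended nonnegative reals\<close>

lemma ennpowr_mono: "x \<le> y \<Longrightarrow> 0 \<le> r \<Longrightarrow> ennpowr x r \<le> ennpowr y r"
  by (auto simp: ennpowr_def top_unique less_top intro!: ennreal_leI powr_mono2 enn2real_mono)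

lemma ennpowr_ennpowr: "ennpowr (ennpowr x r) s = ennpowr x (r * s)"
  by (simp add: ennpowr_def powr_powr)

lemma ennpowr_mult:
  assumes "c > 0"
  shows "ennpowr (ennreal c * x) r = ennreal (c powr r) * ennpowr x r"
proof (cases x)
  case (real t)
  hence "ennreal c * x = ennreal (c * t)"
    using assms by (simp add: ennreal_mult)
  hence "ennpowr (ennreal c * x) r = ennreal ((c * t) powr r)"
    using assms real(1) by (simp only: ennpowr_def) simp
  also have "\<dots> = ennreal (c powr r) * ennreal (t powr r)"
    using assms real(1) by (simp add: powr_mult ennreal_mult)
  finally show ?thesis
    using real by (simp add: ennpowr_def)
next
  case top
  thus ?thesis
    using assms by (simp add: ennpowr_def ennreal_mult_top)
qed

lemma ennpowr_one: "ennpowr x 1 = x"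
  by (cases x) (simp_all add: ennpowr_def)

section \<open>Doubling and the measures of Carleson squares\<close>

lemma Delta2_doubling:
  assumes "Delta2 M"
  obtains D :: real where "D > 0" "\<And>r. r > 0 \<Longrightarrow> emeasure M {0..<2 * r} \<le> ennreal D * emeasure M {0..<r}"
proof -
  define S where "S = (SUP r\<in>{0<..}. emeasure M {0..<2 * r} / emeasure M {0..<r})"
  have "S < top"
    using assms by (simp add: Delta2_def S_def)
  then obtain s where s: "s \<ge> 0" "S = ennreal s"
    by (cases S) auto
  \<comment> \<open>Adding 1 to the supremum makes the constant positive from
    \<open>s \<ge> 0\<close> alone.\<close>
  have "emeasure M {0..<2 * r} \<le> ennreal (s + 1) * emeasure M {0..<r}" if "r > 0" for r
  proof -
    have r: "emeasure M {0..<r} \<noteq> 0" "emeasure M {0..<r} \<noteq> top"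
      using assms that by (auto simp: Delta2_def)
    \<comment> \<open>Cancelling in \<open>ennreal\<close> is legitimate because the denominator is
      neither 0 nor \<open>top\<close>.\<close>
    have "emeasure M {0..<2 * r} = emeasure M {0..<2 * r} / emeasure M {0..<r} * emeasure M {0..<r}"
      using r by (simp add: ennreal_divide_times ennreal_divide_self less_top zero_less_iff_neq_zero)
    also have "\<dots> \<le> ennreal (s + 1) * emeasure M {0..<r}"
    proof (rule mult_right_mono)
      have "emeasure M {0..<2 * r} / emeasure M {0..<r} \<le> S"
        unfolding S_def using that by (intro SUP_upper) auto
      also have "S \<le> ennreal (s + 1)"
        using s by (simp add: ennreal_leI)
      finally show "emeasure M {0..<2 * r} / emeasure M {0..<r} \<le> ennreal (s + 1)" .
    qed simp
    finally show ?thesis .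
  qed
  thus thesis
    using that[of "s + 1"] s by simp
qed

lemma carleson_square_borel [measurable]: "carleson_square a \<in> sets borel"
proof -
  have "{z \<in> space borel. 0 \<le> Re z \<and> Re z < 2 * Re a \<and> \<bar>Im z - Im a\<bar> \<le> Re a} \<in> sets borel"
    by measurable
  thus ?thesis
    by (simp add: carleson_square_def)
qed

lemma closed_closed_right_half_plane: "closed closed_right_half_plane"
  unfolding closed_right_half_plane_def by (simp add: closed_halfspace_Re_ge)

lemma sets_half_plane_measure:
  "sets (half_plane_measure M) = sets (restrict_space borel closed_right_half_plane)"
  by (simp add: half_plane_measure_def)

lemma sets_half_plane_measureI:
  assumes "A \<in> sets borel" "A \<subseteq> closed_right_half_plane"
  shows "A \<in> sets (half_plane_measure M)"
  using assms closed_closed_right_half_plane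
  by (auto simp: sets_half_plane_measure sets_restrict_space_iff)

lemma space_half_plane_measure: "space (half_plane_measure M) = closed_right_half_plane"
  by (simp add: half_plane_measure_def space_restrict_space)

lemma carleson_square_subset: "carleson_square a \<subseteq> closed_right_half_plane"
  by (auto simp: carleson_square_def closed_right_half_plane_def)

text \<open>In coordinates the square is a rectangle. As it is half open on the right, its real side
  is exactly an interval of the kind that \<open>Delta2\<close> controls; the imaginary side
  contributes its Lebesgue length. The product formula rests on sigma-finiteness of
  \<open>lborel\<close>.\<close>

lemma emeasure_carleson_square:
  assumes "borel_measure_on {0..} M" "Re a > 0"
  shows "emeasure (half_plane_measure M) (carleson_square a) =
    emeasure M {0..<2 * Re a} * ennreal (2 * Re a)"
proof -
  have sM: "sets M = sets (restrict_space borel {0::real..})"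
    using assms by (simp add: borel_measure_on_def)
  have sp: "space M = {0..}"
    using sets_eq_imp_space_eq[OF sM] by (simp add: space_restrict_space)
  have sets: "{0..<2 * Re a} \<in> sets M"
    by (auto simp: sM sets_restrict_space_iff)
  have "emeasure (half_plane_measure M) (carleson_square a) =
      emeasure (M \<Otimes>\<^sub>M lborel)
        ((\<lambda>(x, y). Complex x y) -` carleson_square a \<inter> space (M \<Otimes>\<^sub>M lborel))"
    unfolding half_plane_measure_def
    using sets_half_plane_measureI[OF carleson_square_borel carleson_square_subset]
    by (intro emeasure_distr measurable_half_plane_map assms)
       (simp add: sets_half_plane_measure)
  also have "(\<lambda>(x, y). Complex x y) -` carleson_square a \<inter> space (M \<Otimes>\<^sub>M lborel) =
      {0..<2 * Re a} \<times> {Im a - Re a..Im a + Re a}"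
    by (auto simp: carleson_square_def space_pair_measure sp abs_le_iff)
  also have "emeasure (M \<Otimes>\<^sub>M lborel) \<dots> = emeasure M {0..<2 * Re a} * ennreal (2 * Re a)"
    using assms sets by (subst lborel.emeasure_pair_measure_Times) auto
  finally show ?thesis .
qed

text \<open>Each doubling of the square costs a factor \<open>D\<close> on the real side, by the
  doubling condition, and a factor 2 in the length of the imaginary side.\<close>

lemma emeasure_dilated_square_le:
  assumes "borel_measure_on {0..} M" and r: "Re a > 0" and "D > 0"
    and D: "\<And>r. r > 0 \<Longrightarrow> emeasure M {0..<2 * r} \<le> ennreal D * emeasure M {0..<r}"
  shows "emeasure (half_plane_measure M) (carleson_square (Complex (2 ^ k * Re a) (Im a))) \<le>
    ennreal ((2 * D) ^ k) * emeasure (half_plane_measure M) (carleson_square a)"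
proof -
  have "emeasure M {0..<2 * (2 ^ k * Re a)} \<le> ennreal (D ^ k) * emeasure M {0..<2 * Re a}"
  proof (induction k)
    case (Suc k)
    have "emeasure M {0..<2 * (2 ^ Suc k * Re a)} \<le>
        ennreal D * emeasure M {0..<2 * (2 ^ k * Re a)}"
      using D[of "2 * (2 ^ k * Re a)"] r by (simp add: mult.assoc)
    also have "\<dots> \<le> ennreal D * (ennreal (D ^ k) * emeasure M {0..<2 * Re a})"
      using Suc by (intro mult_left_mono) auto
    finally show ?case
      using \<open>D > 0\<close> by (simp add: ennreal_mult mult.assoc)
  qed simp
  hence "emeasure M {0..<2 * (2 ^ k * Re a)} * ennreal (2 * (2 ^ k * Re a)) \<le>
      ennreal (D ^ k) * emeasure M {0..<2 * Re a} * ennreal (2 ^ k * (2 * Re a))"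
    by (intro mult_mono) (auto simp: mult_ac)
  also have "\<dots> = ennreal ((2 * D) ^ k) * (emeasure M {0..<2 * Re a} * ennreal (2 * Re a))"
    using r \<open>D > 0\<close> by (simp add: ennreal_mult power_mult_distrib mult_ac)
  finally show ?thesis
    using assms(1) r by (simp add: emeasure_carleson_square)
qed

section \<open>Integrating the test function over dyadic squares\<close>

text \<open>The single term belonging to the least \<open>k\<close> with \<open>z\<close> in
  \<open>Q_k\<close> already dominates the left side, so no passage to annuli is made. The shift
  \<open>\<epsilon>\<close> only moves the point away from the pole \<open>- cnj a\<close>, so the
  right side can be free of it.\<close>

lemma inverse_power_le_sum_squares:
  assumes r: "Re a > 0" and z: "z \<in> closed_right_half_plane" and "\<epsilon> \<ge> 0"
  shows "ennreal ((Re a / norm (z + of_real \<epsilon> + cnj a)) ^ N) \<le>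
    (\<Sum>k. ennreal ((2 / 2 ^ k) ^ N) * indicator (carleson_square (Complex (2 ^ k * Re a) (Im a))) z)"
    (is "?L \<le> (\<Sum>k. ?t k)")
proof -
  define w where "w = z + of_real \<epsilon> + cnj a"
  let ?Q = "\<lambda>k. carleson_square (Complex (2 ^ k * Re a) (Im a))"
  have re: "Re z \<ge> 0"
    using z by (simp add: closed_right_half_plane_def)
  have w1: "Re z + Re a \<le> norm w" and w2: "\<bar>Im z - Im a\<bar> \<le> norm w"
    using abs_Re_le_cmod[of w] abs_Im_le_cmod[of w] re \<open>\<epsilon> \<ge> 0\<close> by (auto simp: w_def)
  have "\<exists>k. z \<in> ?Q k"
  proof -
    obtain k where k: "(Re z + \<bar>Im z - Im a\<bar>) / Re a < 2 ^ k"
      using real_arch_pow[of 2] by auto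
    hence "Re z + \<bar>Im z - Im a\<bar> < 2 ^ k * Re a"
      using r by (simp add: field_simps)
    hence "z \<in> ?Q k"
      using re r by (auto simp: carleson_square_def)
    thus ?thesis ..
  qed
  then obtain k where k: "z \<in> ?Q k" "\<And>j. j < k \<Longrightarrow> z \<notin> ?Q j"
    using exists_least_iff[of "\<lambda>k. z \<in> ?Q k"] by blast
  \<comment> \<open>The factor 2 pays for the step from \<open>k\<close> to \<open>k - 1\<close>:
    minimality keeps \<open>z\<close> out of the previous square only. For \<open>k = 0\<close>
    there is no previous square, and \<open>Re w \<ge> Re a\<close> is enough.\<close>
  have "2 ^ k * Re a \<le> 2 * norm w"
  proof (cases k)
    case (Suc j)
    hence "z \<notin> ?Q j"
      using k by simp
    hence "2 ^ j * Re a \<le> norm w"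
    proof -
      \<comment> \<open>A point outside the square lies either to its right, where \<open>w1\<close>
        applies, or above or below it, where \<open>w2\<close> applies.\<close>
      have "2 * (2 ^ j * Re a) \<le> Re z \<or> 2 ^ j * Re a < \<bar>Im z - Im a\<bar>"
        using \<open>z \<notin> ?Q j\<close> re by (auto simp: carleson_square_def)
      moreover have "0 \<le> 2 ^ j * Re a"
        using r by simp
      ultimately show ?thesis
        using w1 w2 r by linarith
    qed
    thus ?thesis
      by (simp add: Suc)
  qed (use w1 re r in simp)
  moreover have "norm w > 0"
    using w1 re r by linarith
  ultimately have "Re a / norm w \<le> 2 / 2 ^ k"
    by (simp add: field_simps)
  hence "?L \<le> ?t k"
    using k r by (auto simp: w_def intro!: ennreal_leI power_mono)
  also have "?t k \<le> (\<Sum>k. ?t k)"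
  proof -
    have "f k \<le> (\<Sum>k. f k)" for f :: "nat \<Rightarrow> ennreal"
      using sum_le_suminf[of f "{k}"] by simp
    thus ?thesis .
  qed
  finally show ?thesis .
qed

text \<open>The bound is uniform in \<open>\<epsilon>\<close>, so it survives the supremum in
  \<open>Ap_norm_pow\<close>. Its constant is the sum of the series
  \<open>2 ^ N * (1 / 2) ^ k\<close>.\<close>

lemma nn_integral_inverse_power_le:
  assumes "borel_measure_on {0..} M" and r: "Re a > 0" and "D > 0" and N: "4 * D \<le> 2 ^ N" and "\<epsilon> \<ge> 0"
    and D: "\<And>r. r > 0 \<Longrightarrow> emeasure M {0..<2 * r} \<le> ennreal D * emeasure M {0..<r}"
  shows "(\<integral>\<^sup>+ z. ennreal ((Re a / norm (z + of_real \<epsilon> + cnj a)) ^ N) \<partial>half_plane_measure M) \<le>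
    ennreal (2 ^ (N + 1)) * emeasure (half_plane_measure M) (carleson_square a)" (is "?I \<le> _")
proof -
  let ?H = "half_plane_measure M"
  let ?Q = "\<lambda>k. carleson_square (Complex (2 ^ k * Re a) (Im a))"
  have [measurable]: "?Q k \<in> sets ?H" for k
    by (intro sets_half_plane_measureI carleson_square_borel carleson_square_subset)
  have "?I \<le> (\<integral>\<^sup>+ z. (\<Sum>k. ennreal ((2 / 2 ^ k) ^ N) * indicator (?Q k) z) \<partial>?H)"
    using r \<open>\<epsilon> \<ge> 0\<close>
    by (intro nn_integral_mono inverse_power_le_sum_squares) (auto simp: space_half_plane_measure)
  also have "\<dots> = (\<Sum>k. ennreal ((2 / 2 ^ k) ^ N) * emeasure ?H (?Q k))"
    by (simp add: nn_integral_suminf nn_integral_cmult_indicator)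
  also have "\<dots> \<le> (\<Sum>k. ennreal (2 ^ N * (1 / 2) ^ k) * emeasure ?H (carleson_square a))"
  proof (intro suminf_le summableI)
    fix k
    have "ennreal ((2 / 2 ^ k) ^ N) * emeasure ?H (?Q k) \<le>
        ennreal ((2 / 2 ^ k) ^ N) * (ennreal ((2 * D) ^ k) * emeasure ?H (carleson_square a))"
      using assms by (intro mult_left_mono emeasure_dilated_square_le) auto
    also have "\<dots> = ennreal ((2 / 2 ^ k) ^ N * (2 * D) ^ k) * emeasure ?H (carleson_square a)"
      using \<open>D > 0\<close> by (simp add: ennreal_mult mult.assoc)
    also have "\<dots> \<le> ennreal (2 ^ N * (1 / 2) ^ k) * emeasure ?H (carleson_square a)"
    proof (intro mult_right_mono ennreal_leI)
      \<comment> \<open>Collecting the \<open>k\<close>-th powers exposes the ratio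
        \<open>2 * D / 2 ^ N\<close>, which the choice of \<open>N\<close> makes at most
        1/2.\<close>
      have "(2 / 2 ^ k) ^ N * (2 * D) ^ k = 2 ^ N * (2 * D / 2 ^ N) ^ k"
        by (simp add: power_divide mult.commute flip: power_mult)
      also have "\<dots> \<le> 2 ^ N * (1 / 2) ^ k"
        using N \<open>D > 0\<close> by (intro mult_left_mono power_mono) (auto simp: field_simps)
      finally show "(2 / 2 ^ k) ^ N * (2 * D) ^ k \<le> 2 ^ N * (1 / 2) ^ k" .
    qed simp
    finally show "ennreal ((2 / 2 ^ k) ^ N) * emeasure ?H (?Q k) \<le>
      ennreal (2 ^ N * (1 / 2) ^ k) * emeasure ?H (carleson_square a)" .
  qed
  also have "\<dots> = (\<Sum>k. ennreal (2 ^ N * (1 / 2) ^ k)) * emeasure ?H (carleson_square a)"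
    by (rule ennreal_suminf_multc)
  also have "(\<Sum>k. ennreal (2 ^ N * (1 / 2) ^ k)) = ennreal (2 ^ N * 2)"
    using sums_mult[OF geometric_sums[of "1 / 2 :: real"], of "2 ^ N"]
    by (intro suminf_ennreal_eq) auto
  finally show ?thesis
    by (simp add: mult.commute)
qed

section \<open>Derivatives of the test function\<close>

text \<open>Repeated differentiation brings down the exponents \<open>N\<close>,
  \<open>N + 1\<close>, and so on, with alternating signs; their product is a rising
  factorial.\<close>

lemma higher_deriv_inverse_power:
  assumes "Re (z + c) > 0"
  shows "(deriv ^^ n) (\<lambda>z. (b / (z + c)) ^ N) z =
    (-1) ^ n * pochhammer (of_nat N) n * b ^ N / (z + c) ^ (N + n)"
  using assms
proof (induction n arbitrary: z)
  case (Suc n)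
  define g where "g = (-1) ^ n * pochhammer (of_nat N) n * b ^ N"
  have nz: "z + c \<noteq> 0"
    using Suc.prems by force
  \<comment> \<open>The next derivative needs the induction formula on a neighbourhood of
    \<open>z\<close>; hence \<open>z\<close> is arbitrary in the induction, and openness of the half
    plane is used.\<close>
  have "open {z. Re (z + c) > 0}"
    by (intro open_Collect_less continuous_intros)
  hence "\<forall>\<^sub>F w in nhds z. Re (w + c) > 0"
    using Suc.prems eventually_nhds_in_open[of "{z. Re (z + c) > 0}" z] by simp
  hence "\<forall>\<^sub>F w in nhds z. (deriv ^^ n) (\<lambda>z. (b / (z + c)) ^ N) w = g / (w + c) ^ (N + n)"
    by eventually_elim (simp add: Suc.IH g_def)
  hence "(deriv ^^ Suc n) (\<lambda>z. (b / (z + c)) ^ N) z = deriv (\<lambda>w. g / (w + c) ^ (N + n)) z"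
    by (simp add: deriv_cong_ev)
  also have "\<dots> = - g * of_nat (N + n) / (z + c) ^ (N + Suc n)"
  proof (rule DERIV_imp_deriv, cases "N + n")
    \<comment> \<open>With exponent 0 the function is constant and the factor
      \<open>of_nat (N + n)\<close> vanishes; the power rule below is for exponents
      \<open>Suc j\<close>.\<close>
    case 0
    then show "((\<lambda>w. g / (w + c) ^ (N + n)) has_field_derivative
        - g * of_nat (N + n) / (z + c) ^ (N + Suc n)) (at z)"
      by simp
  next
    case (Suc j)
    have "((\<lambda>w. w + c) has_field_derivative 1) (at z)"
      by (auto intro!: derivative_eq_intros)
    from DERIV_quotient[OF DERIV_const DERIV_power_Suc[OF this, of j], of g] nz
    have "((\<lambda>w. g / (w + c) ^ Suc j) has_field_derivative
        - (of_nat (Suc j) * (z + c) ^ j * g) / ((z + c) ^ Suc j) ^ 2) (at z)"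
      by (simp add: numeral_2_eq_2)
    also have "- (of_nat (Suc j) * (z + c) ^ j * g) / ((z + c) ^ Suc j) ^ 2 =
        - g * of_nat (Suc j) / (z + c) ^ Suc (Suc j)"
      using nz by (simp add: divide_simps power2_eq_square)
    finally show "((\<lambda>w. g / (w + c) ^ (N + n)) has_field_derivative
        - g * of_nat (N + n) / (z + c) ^ (N + Suc n)) (at z)"
      by (simp only: add_Suc_right Suc)
  qed
  finally show ?case
    by (simp add: g_def pochhammer_rec')
qed (simp add: power_divide)

lemma norm_higher_deriv_inverse_power_le:
  assumes r: "Re a > 0" and "Re z \<ge> 0" and "p \<ge> 1"
  shows "norm ((deriv ^^ n) (\<lambda>z. (of_real (Re a) / (z + cnj a)) ^ N) z) powr p \<le>
    pochhammer (real N) n powr p / Re a powr (real n * p) * (Re a / norm (z + cnj a)) ^ N"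
proof -
  define t where "t = Re a / norm (z + cnj a)"
  define P where "P = pochhammer (real N) n"
  have P: "P \<ge> 0"
    unfolding P_def by (simp add: pochhammer_of_nat)
  have w: "Re a \<le> norm (z + cnj a)"
    using complex_Re_le_cmod[of "z + cnj a"] assms by simp
  hence t: "0 \<le> t" "t \<le> 1"
    using r by (auto simp: t_def divide_le_eq_1)
  have "norm ((deriv ^^ n) (\<lambda>z. (of_real (Re a) / (z + cnj a)) ^ N) z) =
      P * Re a ^ N / norm (z + cnj a) ^ (N + n)"
  proof -
    have "norm (pochhammer (of_nat N :: complex) n) = P"
      by (simp add: P_def pochhammer_of_nat)
    thus ?thesis
      using assms by (simp add: higher_deriv_inverse_power norm_divide norm_mult norm_power)
  qed
  \<comment> \<open>The \<open>n\<close> additional powers of the denominator split into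
    \<open>t ^ n\<close> and \<open>1 / Re a ^ n\<close>, the source of the weight in the
    theorem.\<close>
  also have "\<dots> = P / Re a ^ n * (t ^ N * t ^ n)"
    using w r by (simp add: t_def power_divide power_add)
  finally have "norm ((deriv ^^ n) (\<lambda>z. (of_real (Re a) / (z + cnj a)) ^ N) z) powr p =
      P powr p / (Re a ^ n) powr p * (t ^ N * t ^ n) powr p"
    using P r t by (simp add: powr_mult powr_divide)
  also have "(Re a ^ n) powr p = Re a powr (real n * p)"
    using r by (simp add: powr_powr flip: powr_realpow)
  also have "P powr p / Re a powr (real n * p) * (t ^ N * t ^ n) powr p \<le>
      P powr p / Re a powr (real n * p) * t ^ N"
  proof (intro mult_left_mono)
    have le: "t ^ N * t ^ n \<le> t ^ N"
      using t by (simp add: mult_left_le power_le_one)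
    have "(t ^ N * t ^ n) powr p \<le> (t ^ N * t ^ n) powr 1"
      using t \<open>p \<ge> 1\<close> by (intro powr_mono') (auto simp: mult_le_one power_le_one)
    also have "\<dots> \<le> t ^ N"
      using le t by simp
    finally show "(t ^ N * t ^ n) powr p \<le> t ^ N" .
  qed simp
  finally show ?thesis
    by (simp add: t_def P_def)
qed

text \<open>The pointwise derivative bound is integrated, and the result is arranged as a constant
  free of \<open>a\<close> times the \<open>n\<close>-th summand of the theorem.\<close>

lemma Ap_norm_pow_higher_deriv_inverse_power_le:
  assumes "borel_measure_on {0..} M" and r: "Re a > 0" and "D > 0" and N: "4 * D \<le> 2 ^ N" and "p \<ge> 1"
    and D: "\<And>r. r > 0 \<Longrightarrow> emeasure M {0..<2 * r} \<le> ennreal D * emeasure M {0..<r}"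
  shows "Ap_norm_pow p (half_plane_measure M) ((deriv ^^ n) (\<lambda>z. (of_real (Re a) / (z + cnj a)) ^ N)) \<le>
    ennreal (2 ^ (N + 1) * pochhammer (real N) n powr p) *
      (emeasure (half_plane_measure M) (closure (carleson_square a)) / ennreal (Re a powr (real n * p)))"
  unfolding Ap_norm_pow_def
proof (rule SUP_least)
  fix \<epsilon> :: real
  assume "\<epsilon> \<in> {0<..}"
  hence \<epsilon>: "\<epsilon> > 0" by simp
  let ?H = "half_plane_measure M"
  define c where "c = pochhammer (real N) n powr p / Re a powr (real n * p)"
  have c: "c \<ge> 0"
    by (simp add: c_def)
  have [measurable]: "(\<lambda>z. ennreal ((Re a / norm (z + of_real \<epsilon> + cnj a)) ^ N)) \<in> borel_measurable ?H"
  proof -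
    have "(\<lambda>z::complex. ennreal ((Re a / norm (z + of_real \<epsilon> + cnj a)) ^ N)) \<in> borel_measurable borel"
      by measurable
    hence "(\<lambda>z::complex. ennreal ((Re a / norm (z + of_real \<epsilon> + cnj a)) ^ N)) \<in>
        borel_measurable (restrict_space borel closed_right_half_plane)"
      by (rule measurable_restrict_space1)
    thus ?thesis
      using measurable_cong_sets[OF sets_half_plane_measure refl] by blast
  qed
  have "(\<integral>\<^sup>+ z. ennreal (norm ((deriv ^^ n) (\<lambda>z. (of_real (Re a) / (z + cnj a)) ^ N) (z + of_real \<epsilon>)) powr p) \<partial>?H)
      \<le> (\<integral>\<^sup>+ z. ennreal c * ennreal ((Re a / norm (z + of_real \<epsilon> + cnj a)) ^ N) \<partial>?H)"
  proof (intro nn_integral_mono)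
    fix z
    assume "z \<in> space ?H"
    hence "Re (z + of_real \<epsilon>) \<ge> 0"
      using \<epsilon> by (simp add: space_half_plane_measure closed_right_half_plane_def)
    from norm_higher_deriv_inverse_power_le[OF r this \<open>p \<ge> 1\<close>, of n N]
    show "ennreal (norm ((deriv ^^ n) (\<lambda>z. (of_real (Re a) / (z + cnj a)) ^ N) (z + of_real \<epsilon>)) powr p) \<le>
        ennreal c * ennreal ((Re a / norm (z + of_real \<epsilon> + cnj a)) ^ N)"
      using c r by (simp add: c_def ennreal_leI flip: ennreal_mult)
  qed
  also have "\<dots> = ennreal c * (\<integral>\<^sup>+ z. ennreal ((Re a / norm (z + of_real \<epsilon> + cnj a)) ^ N) \<partial>?H)"
    by (rule nn_integral_cmult) measurable
  also have "\<dots> \<le> ennreal c * (ennreal (2 ^ (N + 1)) * emeasure ?H (carleson_square a))"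
    using assms \<epsilon> by (intro mult_left_mono nn_integral_inverse_power_le) auto
  \<comment> \<open>The closure stays inside the closed half plane, so it is measurable and
    monotonicity applies.\<close>
  also have "\<dots> \<le> ennreal c * (ennreal (2 ^ (N + 1)) * emeasure ?H (closure (carleson_square a)))"
    using closure_minimal[OF carleson_square_subset closed_closed_right_half_plane]
    by (intro mult_left_mono emeasure_mono closure_subset sets_half_plane_measureI) auto
  also have "\<dots> = ennreal (2 ^ (N + 1) * pochhammer (real N) n powr p) *
      (emeasure ?H (closure (carleson_square a)) / ennreal (Re a powr (real n * p)))"
  proof -
    have "ennreal c = ennreal (pochhammer (real N) n powr p) / ennreal (Re a powr (real n * p))"
      using r by (simp add: c_def divide_ennreal)
    thus ?thesis
      by (simp add: ennreal_mult divide_ennreal_def mult_ac)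
  qed
  finally show "(\<integral>\<^sup>+ z. ennreal (norm ((deriv ^^ n) (\<lambda>z. (of_real (Re a) / (z + cnj a)) ^ N) (z + of_real \<epsilon>)) powr p) \<partial>?H)
    \<le> ennreal (2 ^ (N + 1) * pochhammer (real N) n powr p) *
      (emeasure ?H (closure (carleson_square a)) / ennreal (Re a powr (real n * p)))" .
qed

section \<open>Lower bound for the test function on the square\<close>

text \<open>This is Chebyshev's inequality for the set where the test function is at least
  \<open>1 / 4 ^ N\<close> in modulus, which contains the square.\<close>

lemma emeasure_carleson_square_le_Lq_norm:
  assumes \<mu>: "borel_measure_on right_half_plane \<mu>" and r: "Re a > 0" and "q \<ge> 1"
  shows "emeasure \<mu> (carleson_square a \<inter> right_half_plane) \<le>
    ennreal ((4 ^ N) powr q) * ennpowr (Lq_norm q \<mu> (\<lambda>z. (of_real (Re a) / (z + cnj a)) ^ N)) q"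
proof -
  let ?Q = "carleson_square a \<inter> right_half_plane"
  let ?F = "\<lambda>z. (of_real (Re a) / (z + cnj a)) ^ N"
  have "open right_half_plane"
    unfolding right_half_plane_def by (simp add: open_halfspace_Re_gt)
  hence Q: "?Q \<in> sets \<mu>"
    using \<mu> by (auto simp: borel_measure_on_def sets_restrict_space_iff)
  have "ennreal (1 / (4 ^ N) powr q) * emeasure \<mu> ?Q =
      (\<integral>\<^sup>+ z. ennreal (1 / (4 ^ N) powr q) * indicator ?Q z \<partial>\<mu>)"
    using Q by (simp add: nn_integral_cmult_indicator)
  also have "\<dots> \<le> (\<integral>\<^sup>+ z. ennreal (norm (?F z) powr q) \<partial>\<mu>)"
  proof (intro nn_integral_mono)
    fix z
    have "1 / (4 ^ N) powr q \<le> norm (?F z) powr q" if "z \<in> ?Q"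
    proof -
      \<comment> \<open>On the square the real part is at most \<open>3 * Re a\<close> and the
        imaginary part at most \<open>Re a\<close>, which gives the 4.\<close>
      have "norm (z + cnj a) \<le> \<bar>Re (z + cnj a)\<bar> + \<bar>Im (z + cnj a)\<bar>"
        by (rule cmod_le)
      also have "\<dots> \<le> 4 * Re a"
        using that r by (auto simp: carleson_square_def)
      finally have "norm (z + cnj a) \<le> 4 * Re a" .
      moreover have "norm (z + cnj a) > 0"
        using complex_Re_le_cmod[of "z + cnj a"] that r by (auto simp: right_half_plane_def)
      ultimately have "1 / 4 \<le> Re a / norm (z + cnj a)"
        by (simp add: field_simps)
      hence "(1 / 4) ^ N \<le> norm (?F z)"
        using r by (auto simp: norm_divide norm_power intro!: power_mono)
      hence "((1 / 4) ^ N) powr q \<le> norm (?F z) powr q"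
        using \<open>q \<ge> 1\<close> by (intro powr_mono2) auto
      thus ?thesis
        by (simp add: power_divide powr_divide)
    qed
    thus "ennreal (1 / (4 ^ N) powr q) * indicator ?Q z \<le> ennreal (norm (?F z) powr q)"
      by (auto simp: indicator_def intro!: ennreal_leI)
  qed
  also have "\<dots> = ennpowr (Lq_norm q \<mu> ?F) q"
    using \<open>q \<ge> 1\<close> by (simp add: Lq_norm_def ennpowr_ennpowr ennpowr_one)
  finally have "ennreal ((4 ^ N) powr q) * (ennreal (1 / (4 ^ N) powr q) * emeasure \<mu> ?Q) \<le>
      ennreal ((4 ^ N) powr q) * ennpowr (Lq_norm q \<mu> ?F) q"
    by (rule mult_left_mono) simp
  thus ?thesis
    by (simp flip: mult.assoc ennreal_mult)
qed

section \<open>Testing the embedding\<close>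

theorem theorem3:
  fixes p q :: real and m :: nat
    and \<nu>' :: "nat \<Rightarrow> real measure" and \<nu> :: "nat \<Rightarrow> complex measure"
    and \<mu> :: "complex measure"
  assumes "1 \<le> p" and "1 \<le> q"
    and "\<And>n. n \<le> m \<Longrightarrow> regular_borel_measure_on {0..} (\<nu>' n)"
    and "\<And>n. n \<le> m \<Longrightarrow> Delta2 (\<nu>' n)"
    and "\<And>n. n \<le> m \<Longrightarrow> \<nu> n = half_plane_measure (\<nu>' n)"
    and "borel_measure_on right_half_plane \<mu>"
    and "bounded_embedding p m \<nu> q \<mu>"
  shows "\<exists>C::real. C > 0 \<and> (\<forall>a\<in>right_half_plane.
           emeasure \<mu> (carleson_square a \<inter> right_half_plane) \<le>
             ennreal C * ennpowr (\<Sum>n\<le>m. emeasure (\<nu> n) (closure (carleson_square a)) /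
                                   ennreal (Re a powr (real n * p))) (q / p))"
proof -
  have borel: "borel_measure_on {0..} (\<nu>' n)" if "n \<le> m" for n
    using assms(3)[OF that] by (simp add: regular_borel_measure_on_def)
  have "\<exists>D>0. \<forall>r>0. emeasure (\<nu>' n) {0..<2 * r} \<le> ennreal D * emeasure (\<nu>' n) {0..<r}"
    if "n \<le> m" for n
    using Delta2_doubling[OF assms(4)[OF that]] by metis
  then obtain D :: "nat \<Rightarrow> real" where D: "\<And>n. n \<le> m \<Longrightarrow> D n > 0"
    "\<And>n r. n \<le> m \<Longrightarrow> r > 0 \<Longrightarrow> emeasure (\<nu>' n) {0..<2 * r} \<le> ennreal (D n) * emeasure (\<nu>' n) {0..<r}"
    by metis
  \<comment> \<open>One exponent has to serve all the measures, so it is chosen for the largest of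
    the finitely many doubling constants.\<close>
  obtain N :: nat where "4 * Max (D ` {..m}) < 2 ^ N"
    using real_arch_pow[of 2] by auto
  moreover have "D n \<le> Max (D ` {..m})" if "n \<le> m" for n
    using that by (intro Max_ge) auto
  ultimately have N: "4 * D n \<le> 2 ^ N" if "n \<le> m" for n
    using that by (meson less_imp_le mult_left_mono order_trans zero_le_numeral)
  obtain C where C: "C > 0"
    "\<And>F. F \<in> Ap_space p m \<nu> \<Longrightarrow> Lq_norm q \<mu> F \<le> ennreal C * Ap_norm p m \<nu> F"
    using assms(7) by (auto simp: bounded_embedding_def)
  \<comment> \<open>A sum of nonnegative terms bounds each of them; the term for
    \<open>n = 0\<close> equals 1, which makes \<open>K\<close> positive.\<close>
  define B where "B = (\<Sum>n\<le>m. pochhammer (real N) n powr p)"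
  have B: "pochhammer (real N) n powr p \<le> B" if "n \<le> m" for n
    unfolding B_def using that by (intro member_le_sum) auto
  define K where "K = 2 ^ (N + 1) * B"
  have K: "K > 0"
    using B[of 0] by (simp add: K_def)
  \<comment> \<open>The three factors come from the lower bound on the square, the embedding
    constant and the norm of the test function; none depends on \<open>a\<close>.\<close>
  define E where "E = (4 ^ N) powr q * (C powr q * K powr (q / p))"
  have "E > 0"
    using C K by (simp add: E_def)
  moreover have "emeasure \<mu> (carleson_square a \<inter> right_half_plane) \<le>
      ennreal E * ennpowr (\<Sum>n\<le>m. emeasure (\<nu> n) (closure (carleson_square a)) /
        ennreal (Re a powr (real n * p))) (q / p)" (is "_ \<le> _ * ennpowr ?S _")
    if "a \<in> right_half_plane" for a
  \<comment> \<open>An infinite right side makes the bound trivial; a finite one is what puts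
    \<open>F\<close> into \<open>Ap_space\<close>.\<close>
  proof (cases "?S = top")
    case True
    thus ?thesis
      using \<open>E > 0\<close> by (simp add: ennpowr_def ennreal_mult_top)
  next
    case False
    have r: "Re a > 0"
      using that by (simp add: right_half_plane_def)
    define F where "F = (\<lambda>z. (of_real (Re a) / (z + cnj a)) ^ N)"
    have "Ap_sum_norm_pow p m \<nu> F \<le> (\<Sum>n\<le>m. ennreal K *
        (emeasure (\<nu> n) (closure (carleson_square a)) / ennreal (Re a powr (real n * p))))"
      unfolding Ap_sum_norm_pow_def
    proof (rule sum_mono)
      fix n
      assume "n \<in> {..m}"
      hence n: "n \<le> m" by simp
      have "Ap_norm_pow p (\<nu> n) ((deriv ^^ n) F) \<le>
          ennreal (2 ^ (N + 1) * pochhammer (real N) n powr p) *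
            (emeasure (\<nu> n) (closure (carleson_square a)) / ennreal (Re a powr (real n * p)))"
        unfolding assms(5)[OF n] F_def
        using borel[OF n] r D[OF n] N[OF n] assms(1)
        by (intro Ap_norm_pow_higher_deriv_inverse_power_le) auto
      also have "\<dots> \<le> ennreal K *
          (emeasure (\<nu> n) (closure (carleson_square a)) / ennreal (Re a powr (real n * p)))"
        unfolding K_def using B[OF n] by (intro mult_right_mono ennreal_leI mult_left_mono) auto
      finally show "Ap_norm_pow p (\<nu> n) ((deriv ^^ n) F) \<le> ennreal K *
          (emeasure (\<nu> n) (closure (carleson_square a)) / ennreal (Re a powr (real n * p)))" .
    qed
    hence sum: "Ap_sum_norm_pow p m \<nu> F \<le> ennreal K * ?S"
      by (simp add: sum_distrib_left)
    also have "\<dots> < top"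
      using False by (simp add: ennreal_mult_less_top less_top)
    finally have "Ap_sum_norm_pow p m \<nu> F < top" .
    moreover have "F holomorphic_on right_half_plane"
    proof -
      \<comment> \<open>The only possible pole, \<open>- cnj a\<close>, lies in the left half
        plane.\<close>
      have "z + cnj a \<noteq> 0" if "z \<in> right_half_plane" for z
        using that r complex_Re_le_cmod[of "z + cnj a"] by (auto simp: right_half_plane_def)
      thus ?thesis
        unfolding F_def by (intro holomorphic_intros) auto
    qed
    ultimately have "F \<in> Ap_space p m \<nu>"
      by (simp add: Ap_space_def)
    hence "Lq_norm q \<mu> F \<le> ennreal C * Ap_norm p m \<nu> F"
      by (rule C)
    hence "ennpowr (Lq_norm q \<mu> F) q \<le> ennpowr (ennreal C * Ap_norm p m \<nu> F) q"
      using assms(2) by (intro ennpowr_mono) auto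
    also have "\<dots> = ennreal (C powr q) * ennpowr (Ap_sum_norm_pow p m \<nu> F) (q / p)"
      using C by (simp add: ennpowr_mult Ap_norm_def ennpowr_ennpowr)
    also have "\<dots> \<le> ennreal (C powr q) * ennpowr (ennreal K * ?S) (q / p)"
      using sum assms(1,2) by (intro mult_left_mono ennpowr_mono) auto
    also have "\<dots> = ennreal (C powr q * K powr (q / p)) * ennpowr ?S (q / p)"
      using K by (simp add: ennpowr_mult ennreal_mult mult.assoc)
    finally have "ennreal ((4 ^ N) powr q) * ennpowr (Lq_norm q \<mu> F) q \<le>
        ennreal ((4 ^ N) powr q) * (ennreal (C powr q * K powr (q / p)) * ennpowr ?S (q / p))"
      by (rule mult_left_mono) simp
    also have "\<dots> = ennreal E * ennpowr ?S (q / p)"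
      by (simp add: E_def ennreal_mult mult.assoc)
    finally show ?thesis
      using emeasure_carleson_square_le_Lq_norm[OF assms(6) r assms(2), of N]
      by (simp add: F_def)
  qed
  ultimately show ?thesis
    by blast
qed

end
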